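(* Let $n\ge1$ be an integer, let $\theta\in(\frac{2-n}{2},1]$ if $n=1,2$ and $\theta\in[0,1]$ if $n\geq 3$, and consider $s>\frac{n+4\theta-6}{2}$. Then there is a constant $C=C_{n,\theta}>0$, that only depends on $n$ and $\theta$, such that $$\Vert\Lambda_\theta(t)g\Vert_{L^\infty(\mathbb{R}^n)}\leq C(1+t)^{-\frac{n+2(\theta-1)}{2}}\left[\Vert g\Vert_{L^1(\mathbb{R}^n)}+\Vert g\Vert_{H^s(\mathbb{R}^n)}\right]$$ for all $g\in L^1(\mathbb{R}^n)\cap H^s(\mathbb{R}^n)$ and all $t>0$.
   Context: For $t\geq 0$, $S(t)$ is the Fourier multiplier operator on $\mathbb{R}^n$ with symbol $$m(\xi,t)=e^{-\frac{|\xi|^2t}{2(1+|\xi|^2)}}\,\frac{2(1+|\xi|^2)}{|\xi|^2\sqrt{3+4|\xi|^2}}\,\sin\left(\frac{|\xi|^2\sqrt{3+4|\xi|^2}\,t}{2(1+|\xi|^2)}\right)$$ (equal to $t$ at $\xi=0$), and $\Lambda_\theta(t)=S(t)(I-\Delta)^{-1}(-\Delta)^\theta$, i.e. the Fourier multiplier operator with symbol $m(\xi,t)(1+|\xi|^2)^{-1}|\xi|^{2\theta}$. $H^s(\mathbb{R}^n)$ is the $L^2$-based Sobolev space.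
   Formalization: The constant C is allowed to depend on s as well as on n and θ; a constant depending only on n and θ, uniform over all s > (n+4θ−6)/2, does not exist in general, for example for n = 3, θ = 1, as s decreases to 1/2. *)

theory Defs
  imports "HOL-Analysis.Analysis" "HOL-Probability.Essential_Supremum"
begin

section \<open>Fourier transform and Sobolev norm\<close>

text \<open>
  The unitary normalisation is used throughout, so that the Laplacian has symbol
  minus the square of the norm of the frequency and the Sobolev norm of order 0 is
  the \<open>L\<^sup>2\<close> norm.
\<close>

definition fourier :: "('a::euclidean_space \<Rightarrow> complex) \<Rightarrow> 'a \<Rightarrow> complex" where
  "fourier f \<xi> = complex_of_real ((2 * pi) powr (- real DIM('a) / 2)) *
     (LINT x|lborel. cis (- (x \<bullet> \<xi>)) * f x)"

definition inv_fourier :: "('a::euclidean_space \<Rightarrow> complex) \<Rightarrow> 'a \<Rightarrow> complex" where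
  "inv_fourier f x = complex_of_real ((2 * pi) powr (- real DIM('a) / 2)) *
     (LINT \<xi>|lborel. cis (x \<bullet> \<xi>) * f \<xi>)"

definition L1_norm :: "('a::euclidean_space \<Rightarrow> complex) \<Rightarrow> real" where
  "L1_norm g = (LINT x|lborel. norm (g x))"

text \<open>
  The next two definitions are meant for integrable \<open>g\<close> only: the Fourier transform of
  \<open>g\<close> as a tempered distribution is then the function \<open>fourier g\<close>. The order \<open>s\<close> may be
  any real number, negative ones included.
\<close>

definition in_Hs :: "real \<Rightarrow> ('a::euclidean_space \<Rightarrow> complex) \<Rightarrow> bool" where
  "in_Hs s g \<longleftrightarrow>
     integrable lborel (\<lambda>\<xi>. (1 + (norm \<xi>)\<^sup>2) powr s * (norm (fourier g \<xi>))\<^sup>2)"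

definition Hs_norm :: "real \<Rightarrow> ('a::euclidean_space \<Rightarrow> complex) \<Rightarrow> real" where
  "Hs_norm s g = sqrt (LINT \<xi>|lborel. (1 + (norm \<xi>)\<^sup>2) powr s * (norm (fourier g \<xi>))\<^sup>2)"


section \<open>Tempered distributions and Fourier multipliers\<close>

text \<open>Iterated directional derivatives, the head of the list being applied last.\<close>

fun iter_deriv :: "'a::euclidean_space list \<Rightarrow> ('a \<Rightarrow> complex) \<Rightarrow> 'a \<Rightarrow> complex" where
  "iter_deriv [] f = f"
| "iter_deriv (b # bs) f = (\<lambda>x. frechet_derivative (iter_deriv bs f) (at x) b)"

definition schwartz :: "('a::euclidean_space \<Rightarrow> complex) \<Rightarrow> bool" where
  "schwartz \<phi> \<longleftrightarrow>
     (\<forall>bs\<in>lists Basis.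
        (\<forall>x. iter_deriv bs \<phi> differentiable (at x)) \<and>
        (\<forall>k::nat. bounded (range (\<lambda>x. (1 + norm x) ^ k * norm (iter_deriv bs \<phi> x)))))"

text \<open>
  Distributions are given as functionals on test functions; only their values on
  functions satisfying \<^const>\<open>schwartz\<close> are relevant.
\<close>

definition represents ::
  "('a::euclidean_space \<Rightarrow> complex) \<Rightarrow> (('a \<Rightarrow> complex) \<Rightarrow> complex) \<Rightarrow> bool" where
  "represents h u \<longleftrightarrow> h \<in> borel_measurable lborel \<and>
     (\<forall>\<phi>. schwartz \<phi> \<longrightarrow>
        integrable lborel (\<lambda>x. h x * \<phi> x) \<and> u \<phi> = (LINT x|lborel. h x * \<phi> x))"

text \<open>
  The function representing a distribution is unique up to null sets, so the infimum
  selects its essential supremum; it is \<open>\<infinity>\<close> if no bounded function represents \<open>u\<close>.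
\<close>

definition Linf_norm :: "(('a::euclidean_space \<Rightarrow> complex) \<Rightarrow> complex) \<Rightarrow> ennreal" where
  "Linf_norm u = Inf {esssup lborel (\<lambda>x. ennreal (norm (h x))) | h. represents h u}"

text \<open>
  The tempered distribution whose Fourier transform is \<open>\<sigma>\<close> times that of the integrable
  function \<open>g\<close>, by the duality that moves the inverse Fourier transform onto the test
  function. The integral converges on Schwartz functions whenever \<open>\<sigma>\<close> is bounded and
  measurable, since \<open>fourier g\<close> is bounded and continuous.
\<close>

definition fourier_multiplier ::
  "('a::euclidean_space \<Rightarrow> real) \<Rightarrow> ('a \<Rightarrow> complex) \<Rightarrow> ('a \<Rightarrow> complex) \<Rightarrow> complex" where
  "fourier_multiplier \<sigma> g \<phi> =
     (LINT \<xi>|lborel. complex_of_real (\<sigma> \<xi>) * fourier g \<xi> * inv_fourier \<phi> \<xi>)"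


section \<open>The operators\<close>

definition S_symbol :: "real \<Rightarrow> 'a::euclidean_space \<Rightarrow> real" where
  "S_symbol t \<xi> =
     (if \<xi> = 0 then t
      else exp (- ((norm \<xi>)\<^sup>2 * t) / (2 * (1 + (norm \<xi>)\<^sup>2))) *
           (2 * (1 + (norm \<xi>)\<^sup>2) / ((norm \<xi>)\<^sup>2 * sqrt (3 + 4 * (norm \<xi>)\<^sup>2))) *
           sin ((norm \<xi>)\<^sup>2 * sqrt (3 + 4 * (norm \<xi>)\<^sup>2) * t / (2 * (1 + (norm \<xi>)\<^sup>2))))"

text \<open>The case distinction is needed because \<open>0 powr 0 = 0\<close>.\<close>

definition frac_laplace_symbol :: "real \<Rightarrow> 'a::euclidean_space \<Rightarrow> real" where
  "frac_laplace_symbol \<theta> \<xi> = (if \<theta> = 0 then 1 else norm \<xi> powr (2 * \<theta>))"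

definition Lambda ::
  "real \<Rightarrow> real \<Rightarrow> ('a::euclidean_space \<Rightarrow> complex) \<Rightarrow> ('a \<Rightarrow> complex) \<Rightarrow> complex" where
  "Lambda \<theta> t =
     fourier_multiplier
       (\<lambda>\<xi>. S_symbol t \<xi> * inverse (1 + (norm \<xi>)\<^sup>2) * frac_laplace_symbol \<theta> \<xi>)"

end

theory Submission
  imports Defs
begin

text \<open>
  The supremum norm of \<open>\<Lambda>\<^sub>\<theta>(t) g\<close> is at most a constant times the \<open>L\<^sup>1\<close> norm of its symbol times
  the Fourier transform of \<open>g\<close>. The sine is bounded by 1, even near the origin: the remaining
  singularity is the power \<open>2\<theta> - 2\<close> of the norm, integrable as \<open>n + 2\<theta> - 2 > 0\<close>.
  On the unit ball the symbol is dominated by this power times a Gaussian of variance of order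
  \<open>1 / (1 + t)\<close> and the Fourier transform by the \<open>L\<^sup>1\<close> norm of \<open>g\<close>; scaling gives the decay rate.
  Outside the unit ball the symbol is dominated by \<open>exp (- t / 4)\<close> times the power \<open>2\<theta> - 3\<close>, and
  the Cauchy-Schwarz inequality gives the \<open>H\<^sup>s\<close> norm of \<open>g\<close>, the condition on \<open>s\<close> being precisely
  the convergence of the other factor.
\<close>

section \<open>Integrals of radial functions\<close>

text \<open>Polar coordinates as an identity of measures on the line. Half-lines
  \<open>{..r}\<close> form an intersection-stable generator, and on them both sides give the volume
  of a ball: the density is the derivative of \<open>?V * r ^ ?n\<close>.\<close>

lemma distr_norm_lborel:
  "distr (lborel :: 'a::euclidean_space measure) borel norm =
     density lborel (\<lambda>r. ennreal (real DIM('a) * unit_ball_vol (real DIM('a)) * r ^ (DIM('a) - 1)) * indicator {0..} r)"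
    (is "?M = ?N")
proof (rule measure_eqI_generator_eq[where E = "range atMost" and \<Omega> = UNIV and A = "\<lambda>i::nat. {..real i}"])
  let ?n = "DIM('a)" and ?V = "unit_ball_vol (real DIM('a))"
  have n: "real ?n * ?V \<ge> 0" by simp
  have M: "emeasure ?M {..r} = (if r < 0 then 0 else ennreal (?V * r ^ ?n))" for r
  proof -
    have "emeasure ?M {..r} = emeasure lborel {x::'a. norm x \<le> r}"
      by (subst emeasure_distr) (auto simp: vimage_def)
    also have "{x::'a. norm x \<le> r} = cball 0 r"
      by (auto simp: cball_def)
    also have "emeasure lborel (cball (0::'a) r) = (if r < 0 then 0 else ennreal (?V * r ^ ?n))"
      by (auto simp: emeasure_cball)
    finally show ?thesis .
  qed
  have N: "emeasure ?N {..r} = (if r < 0 then 0 else ennreal (?V * r ^ ?n))" for r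
  proof -
    have "emeasure ?N {..r} = (\<integral>\<^sup>+x. ennreal (real ?n * ?V * x ^ (?n - 1)) * indicator {0..r} x \<partial>lborel)"
      by (subst emeasure_density) (auto intro!: nn_integral_cong simp: indicator_def)
    also have "\<dots> = (if r < 0 then 0 else ennreal (?V * r ^ ?n))"
    proof (cases "r < 0")
      case False
      have "(\<integral>\<^sup>+x. ennreal (real ?n * ?V * x ^ (?n - 1)) * indicator {0..r} x \<partial>lborel) =
             ennreal (?V * r ^ ?n - ?V * 0 ^ ?n)"
      proof (rule nn_integral_FTC_Icc)
        fix x assume "x \<in> {0..r}"
        then show "0 \<le> real ?n * ?V * x ^ (?n - 1)" by simp
        show "((\<lambda>x. ?V * x ^ ?n) has_real_derivative real ?n * ?V * x ^ (?n - 1)) (at x)"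
          by (auto intro!: derivative_eq_intros)
      qed (use False in auto)
      then show ?thesis using False by simp
    qed auto
    finally show ?thesis .
  qed
  show "Int_stable (range (atMost :: real \<Rightarrow> _))"
    by (auto simp: Int_stable_def)
  have b: "sets borel = sigma_sets UNIV (range (atMost :: real \<Rightarrow> _))"
    by (subst borel_eq_atMost) auto
  show "sets ?M = sigma_sets UNIV (range atMost)" "sets ?N = sigma_sets UNIV (range atMost)"
    using b by simp_all
  show "emeasure ?M X = emeasure ?N X" if "X \<in> range atMost" for X
    using that M N by auto
  show "(\<Union>i::nat. {..real i}) = UNIV"
    using real_arch_simple by auto
  show "emeasure ?M {..real i} \<noteq> \<infinity>" for i :: nat
    by (simp add: M)
qed auto

text \<open>Polar coordinates for radial integrands, by change of variables along
  \<open>norm\<close>. The indicator is there because the integral on the right runs over the whole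
  line.\<close>

lemma nn_integral_norm:
  assumes [measurable]: "f \<in> borel_measurable borel"
  shows "(\<integral>\<^sup>+x. f (norm (x::'a::euclidean_space)) \<partial>lborel) =
    ennreal (real DIM('a) * unit_ball_vol (real DIM('a))) * (\<integral>\<^sup>+r. ennreal (r ^ (DIM('a) - 1)) * indicator {0..} r * f r \<partial>lborel)"
proof -
  have "(\<integral>\<^sup>+x. f (norm (x::'a)) \<partial>lborel) = (\<integral>\<^sup>+r. f r \<partial>distr (lborel :: 'a measure) borel norm)"
    by (simp add: nn_integral_distr)
  also have "\<dots> = (\<integral>\<^sup>+r. ennreal (real DIM('a) * unit_ball_vol (real DIM('a))) * (ennreal (r ^ (DIM('a) - 1)) * indicator {0..} r * f r) \<partial>lborel)"
    unfolding distr_norm_lborel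
    by (subst nn_integral_density)
      (auto intro!: nn_integral_cong simp: ennreal_mult' mult_ac indicator_def)
  finally show ?thesis
    by (simp add: nn_integral_cmult)
qed

lemma power_times_powr:
  fixes r p :: real
  assumes "0 \<le> r" "0 < n"
  shows "r ^ (n - 1) * r powr p = r powr (real n + p - 1)"
\<comment> \<open>At \<open>r = 0\<close> both sides vanish, since \<open>0 powr x = 0\<close> for
  every \<open>x\<close>, including \<open>x = 0\<close>.\<close>
proof (cases "r = 0")
  case False
  then have "r ^ (n - 1) = r powr (real n - 1)"
    using assms by (simp add: powr_realpow[symmetric] of_nat_diff)
  then show ?thesis by (simp add: powr_add[symmetric] algebra_simps)
qed auto

text \<open>With the Jacobian the radial exponent is \<open>DIM('a) + p - 1\<close>;
  \<open>p\<close> says that it exceeds -1, which is integrability at the origin.\<close>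

lemma nn_integral_norm_powr_cball:
  fixes p R :: real
  assumes p: "0 < real DIM('a) + p" and R: "0 \<le> R"
  shows "(\<integral>\<^sup>+x. ennreal (norm (x::'a::euclidean_space) powr p) * indicator {x. norm x \<le> R} x \<partial>lborel)
    = ennreal (real DIM('a) * unit_ball_vol (real DIM('a)) * (R powr (real DIM('a) + p) / (real DIM('a) + p)))"
proof -
  let ?n = "DIM('a)" and ?V = "unit_ball_vol (real DIM('a))"
  have "(\<integral>\<^sup>+x. ennreal (norm (x::'a) powr p) * indicator {x. norm x \<le> R} x \<partial>lborel)
     = (\<integral>\<^sup>+x. ennreal (norm (x::'a) powr p) * indicator {..R} (norm x) \<partial>lborel)"
    by (intro nn_integral_cong) (auto simp: indicator_def)
  also have "\<dots> = ennreal (real ?n * ?V) *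
      (\<integral>\<^sup>+r. ennreal (r ^ (?n - 1)) * indicator {0..} r * (ennreal (r powr p) * indicator {..R} r) \<partial>lborel)"
    by (rule nn_integral_norm) measurable
  also have "(\<integral>\<^sup>+r. ennreal (r ^ (?n - 1)) * indicator {0..} r * (ennreal (r powr p) * indicator {..R} r) \<partial>lborel)
     = (\<integral>\<^sup>+r. ennreal (indicator {0..R} r * r powr (real ?n + p - 1)) \<partial>lborel)"
    by (intro nn_integral_cong) (auto simp: indicator_def ennreal_mult'[symmetric] power_times_powr[unfolded One_nat_def])
  also have "\<dots> = ennreal (R powr (real ?n + p - 1 + 1) / (real ?n + p - 1 + 1))"
    by (rule nn_integral_has_integral_lebesgue[OF _ has_integral_powr_from_0]) (use p R in auto)
  finally show ?thesis by (subst ennreal_mult') auto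
qed

text \<open>The counterpart at infinity, where the radial exponent must lie below -1. The
  denominator is negative, so the value is positive in spite of its minus sign.\<close>

lemma nn_integral_norm_powr_outside:
  fixes p R :: real
  assumes p: "real DIM('a) + p < 0" and R: "0 < R"
  shows "(\<integral>\<^sup>+x. ennreal (norm (x::'a::euclidean_space) powr p) * indicator {x. R \<le> norm x} x \<partial>lborel)
    = ennreal (real DIM('a) * unit_ball_vol (real DIM('a)) * (- (R powr (real DIM('a) + p)) / (real DIM('a) + p)))"
proof -
  let ?n = "DIM('a)" and ?V = "unit_ball_vol (real DIM('a))"
  have "(\<integral>\<^sup>+x. ennreal (norm (x::'a) powr p) * indicator {x. R \<le> norm x} x \<partial>lborel)
     = (\<integral>\<^sup>+x. ennreal (norm (x::'a) powr p) * indicator {R..} (norm x) \<partial>lborel)"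
    by (intro nn_integral_cong) (auto simp: indicator_def)
  also have "\<dots> = ennreal (real ?n * ?V) *
      (\<integral>\<^sup>+r. ennreal (r ^ (?n - 1)) * indicator {0..} r * (ennreal (r powr p) * indicator {R..} r) \<partial>lborel)"
    by (rule nn_integral_norm) measurable
  also have "(\<integral>\<^sup>+r. ennreal (r ^ (?n - 1)) * indicator {0..} r * (ennreal (r powr p) * indicator {R..} r) \<partial>lborel)
     = (\<integral>\<^sup>+r. ennreal (indicator {R..} r * r powr (real ?n + p - 1)) \<partial>lborel)"
    using R by (intro nn_integral_cong) (auto simp: indicator_def ennreal_mult'[symmetric] power_times_powr[unfolded One_nat_def])
  also have "\<dots> = ennreal (- (R powr (real ?n + p - 1 + 1)) / (real ?n + p - 1 + 1))"
    by (rule nn_integral_has_integral_lebesgue[OF _ has_integral_powr_to_inf]) (use p R in auto)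
  finally show ?thesis by (subst ennreal_mult') auto
qed

section \<open>Powers against exponentials and Gaussians\<close>

text \<open>Raise \<open>x \<le> exp x\<close> at \<open>x = y / (4 * a)\<close> to the power
  \<open>a\<close>; the exponent becomes \<open>y / 4\<close>. The true maximum, at
  \<open>y = 4 * a\<close>, is smaller by the factor \<open>exp (- a)\<close> only.\<close>

lemma powr_exp_bound:
  fixes a y :: real
  assumes "0 < a" "0 \<le> y"
  shows "y powr a * exp (- y / 4) \<le> (4 * a) powr a"
proof -
  have "y / (4 * a) \<le> exp (y / (4 * a))"
    using exp_ge_add_one_self[of "y / (4 * a)"] by linarith
  then have "(y / (4 * a)) powr a \<le> exp (y / (4 * a)) powr a"
    using assms by (intro powr_mono2) auto
  also have "\<dots> = exp (y / 4)"
    using assms by (simp add: powr_def)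
  finally have "y powr a / (4 * a) powr a \<le> exp (y / 4)"
    using assms by (simp add: powr_divide)
  then show ?thesis
    using assms by (simp add: exp_minus field_simps)
qed

text \<open>
  The Gaussian is bounded by the minimum of 1 and a negative power of \<open>\<tau> * (norm x)\<^sup>2\<close>;
  the integral is split at norm \<open>\<tau> powr (-1/2)\<close>.
\<close>

lemma nn_integral_norm_powr_gaussian:
  fixes p \<tau> :: real
  assumes a: "0 < real DIM('a) + p" and \<tau>: "0 < \<tau>"
  defines "a \<equiv> real DIM('a) + p"
  shows "(\<integral>\<^sup>+x. ennreal (norm (x::'a::euclidean_space) powr p * exp (- (\<tau> * (norm x)\<^sup>2) / 4)) \<partial>lborel)
    \<le> ennreal (real DIM('a) * unit_ball_vol (real DIM('a)) * (1 + (4 * a) powr a) / a * \<tau> powr (- a / 2))"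
proof -
  let ?n = "real DIM('a)" and ?V = "unit_ball_vol (real DIM('a))"
  define R where "R = \<tau> powr (- 1 / 2)"
  define K where "K = (4 * a) powr a"
  have R: "R > 0" "R powr a = \<tau> powr (- a / 2)"
    using \<tau> by (auto simp: R_def powr_powr)
  have apos: "a > 0" using a by (simp add: a_def)
  \<comment> \<open>Using the power \<open>a\<close> of \<open>\<tau> * r\<^sup>2\<close> lowers the
    exponent \<open>p\<close> to \<open>p - 2 * a\<close>; since
    \<open>DIM('a) + p - 2 * a = - a < 0\<close>, the integral then converges at infinity.\<close>
  have tail: "exp (- (\<tau> * r\<^sup>2) / 4) \<le> K * \<tau> powr (- a) * r powr (- 2 * a)" if "r > 0" for r :: real
  proof -
    have "(\<tau> * r\<^sup>2) powr a * exp (- (\<tau> * r\<^sup>2) / 4) \<le> K"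
      unfolding K_def using powr_exp_bound[OF apos, of "\<tau> * r\<^sup>2"] \<tau> by simp
    moreover have "(\<tau> * r\<^sup>2) powr a = \<tau> powr a * r powr (2 * a)"
      using \<tau> that by (simp add: powr_mult powr_powr flip: powr_numeral)
    ultimately show ?thesis
      using \<tau> that by (simp add: powr_minus field_simps)
  qed
  have "(\<integral>\<^sup>+x. ennreal (norm (x::'a) powr p * exp (- (\<tau> * (norm x)\<^sup>2) / 4)) \<partial>lborel)
     \<le> (\<integral>\<^sup>+x. ennreal (norm (x::'a) powr p) * indicator {x. norm x \<le> R} x +
          ennreal (K * \<tau> powr (- a)) * (ennreal (norm x powr (p - 2 * a)) * indicator {x. R \<le> norm x} x) \<partial>lborel)"
  proof (rule nn_integral_mono)
    fix x :: 'a
    show "ennreal (norm x powr p * exp (- (\<tau> * (norm x)\<^sup>2) / 4)) \<le>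
      ennreal (norm x powr p) * indicator {x. norm x \<le> R} x +
      ennreal (K * \<tau> powr (- a)) * (ennreal (norm x powr (p - 2 * a)) * indicator {x. R \<le> norm x} x)"
    proof (cases "norm x \<le> R")
      case True
      have "norm x powr p * exp (- (\<tau> * (norm x)\<^sup>2) / 4) \<le> norm x powr p"
        using \<tau> by (intro mult_left_le) auto
      then show ?thesis using True
        by (auto intro!: add_increasing2 ennreal_leI)
    next
      case False
      then have x: "norm x > 0" using R by linarith
      have "norm x powr p * exp (- (\<tau> * (norm x)\<^sup>2) / 4)
          \<le> norm x powr p * (K * \<tau> powr (- a) * norm x powr (- 2 * a))"
        by (intro mult_left_mono tail x) auto
      also have "\<dots> = K * \<tau> powr (- a) * norm x powr (p - 2 * a)"
        using x by (simp add: powr_diff powr_minus field_simps)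
      finally show ?thesis
        using False by (simp add: ennreal_mult'[symmetric] K_def ennreal_leI)
    qed
  qed
  also have "\<dots> = ennreal (?n * ?V * (R powr a / a)) +
      ennreal (K * \<tau> powr (- a)) * ennreal (?n * ?V * (- (R powr (- a)) / (- a)))"
  proof -
    have "(\<integral>\<^sup>+x. ennreal (norm (x::'a) powr p) * indicator {x. norm x \<le> R} x \<partial>lborel) = ennreal (?n * ?V * (R powr a / a))"
      using nn_integral_norm_powr_cball[OF a, of R] R by (simp add: a_def)
    moreover have e: "?n + (p - 2 * a) = - a"
      by (simp add: a_def)
    have "(\<integral>\<^sup>+x. ennreal (norm (x::'a) powr (p - 2 * a)) * indicator {x. R \<le> norm x} x \<partial>lborel) =
        ennreal (?n * ?V * (- (R powr (- a)) / (- a)))"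
      using nn_integral_norm_powr_outside[where p = "p - 2 * a" and R = R and 'a = 'a] apos R unfolding e by simp
    ultimately show ?thesis
      by (simp add: nn_integral_add nn_integral_cmult)
  qed
  also have "\<dots> = ennreal (?n * ?V * (1 + K) / a * \<tau> powr (- a / 2))"
  proof -
    \<comment> \<open>At this splitting radius the tail scales exactly like the ball, so both
      contributions carry the same power of \<open>\<tau>\<close>.\<close>
    have "R powr (- a) = \<tau> powr (a / 2)"
      by (simp add: R_def powr_powr)
    then have R': "R powr (- a) * \<tau> powr (- a) = \<tau> powr (- a / 2)"
      by (simp add: powr_add[symmetric])
    have "ennreal (?n * ?V * (R powr a / a)) + ennreal (K * \<tau> powr (- a)) * ennreal (?n * ?V * (- (R powr (- a)) / (- a)))
        = ennreal (?n * ?V * (R powr a / a) + K * \<tau> powr (- a) * (?n * ?V * (- (R powr (- a)) / (- a))))"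
      using apos by (simp add: ennreal_mult'[symmetric] ennreal_plus[symmetric] K_def del: ennreal_plus)
    also have "K * \<tau> powr (- a) * (?n * ?V * (- (R powr (- a)) / (- a))) =
        ?n * ?V * K / a * (R powr (- a) * \<tau> powr (- a))"
      by simp
    finally show ?thesis
      unfolding R' R(2) by (simp add: algebra_simps add_divide_distrib)
  qed
  finally show ?thesis by (simp add: K_def)
qed

section \<open>The Fourier transform and Fourier multipliers\<close>

lemma borel_measurable_cis [measurable]: "cis \<in> borel_measurable borel"
  by (intro borel_measurable_continuous_onI continuous_intros)

lemma borel_measurable_fourier [measurable]:
  assumes [measurable]: "g \<in> borel_measurable borel"
  shows "fourier g \<in> borel_measurable borel"
  unfolding fourier_def by measurable

lemma borel_measurable_inv_fourier [measurable]:
  assumes [measurable]: "f \<in> borel_measurable borel"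
  shows "inv_fourier f \<in> borel_measurable borel"
  unfolding inv_fourier_def by measurable

text \<open>The kernel has modulus 1. This uniform bound is what brings \<open>L1_norm\<close> into
  the low-frequency estimate.\<close>

lemma norm_fourier_le:
  fixes g :: "'a::euclidean_space \<Rightarrow> complex"
  shows "norm (fourier g \<xi>) \<le> (2 * pi) powr (- real DIM('a) / 2) * L1_norm g"
proof -
  have "norm (LINT x|lborel. cis (- (x \<bullet> \<xi>)) * g x) \<le> L1_norm g"
    using integral_norm_bound[of lborel "\<lambda>x. cis (- (x \<bullet> \<xi>)) * g x"]
    by (simp add: L1_norm_def norm_mult)
  then show ?thesis
    by (simp add: fourier_def norm_mult mult_left_mono)
qed

text \<open>Stated with a nonnegative integral so that it fits the \<open>ennreal\<close>-valued
  essential supremum.\<close>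

lemma ennreal_norm_inv_fourier_le:
  fixes f :: "'a::euclidean_space \<Rightarrow> complex"
  assumes "integrable lborel f"
  shows "ennreal (norm (inv_fourier f x)) \<le>
    ennreal ((2 * pi) powr (- real DIM('a) / 2)) * (\<integral>\<^sup>+\<xi>. norm (f \<xi>) \<partial>lborel)"
proof -
  have "norm (LINT \<xi>|lborel. cis (x \<bullet> \<xi>) * f \<xi>) \<le> (LINT \<xi>|lborel. norm (f \<xi>))"
    using integral_norm_bound[of lborel "\<lambda>\<xi>. cis (x \<bullet> \<xi>) * f \<xi>"]
    by (simp add: norm_mult)
  then have "norm (inv_fourier f x) \<le> (2 * pi) powr (- real DIM('a) / 2) * (LINT \<xi>|lborel. norm (f \<xi>))"
    by (simp add: inv_fourier_def norm_mult mult_left_mono)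
  then show ?thesis
    using assms by (simp add: nn_integral_eq_integral ennreal_mult'[symmetric] ennreal_leI)
qed

section \<open>Duality with Schwartz functions\<close>

text \<open>The empty list of derivatives gives the decay and the continuity of
  \<open>\<phi>\<close> itself. Decay of order \<open>DIM('a) + 1\<close> is integrable away from
  the unit ball, and on the ball boundedness suffices.\<close>

lemma schwartz_integrable:
  fixes \<phi> :: "'a::euclidean_space \<Rightarrow> complex"
  assumes "schwartz \<phi>"
  shows "integrable lborel \<phi>"
proof -
  let ?k = "Suc DIM('a)"
  have *: "\<phi> differentiable (at x)"
    "bounded (range (\<lambda>x. (1 + norm x) ^ ?k * norm (\<phi> x)))" for x
    using assms unfolding schwartz_def by (auto dest!: bspec[of _ _ "[]"] simp del: power_Suc)
  have "continuous_on UNIV \<phi>"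
    using *(1) by (auto simp: continuous_on_eq_continuous_at differentiable_imp_continuous_within)
  then have [measurable]: "\<phi> \<in> borel_measurable borel"
    by (rule borel_measurable_continuous_onI)
  obtain B where B: "B > 0" "\<And>x. (1 + norm x) ^ ?k * norm (\<phi> x) \<le> B"
    using *(2) unfolding bounded_pos by auto
  have [measurable]: "cball (0::'a) 1 \<in> sets borel"
    by (intro borel_closed closed_cball)
  have "(\<integral>\<^sup>+x. ennreal (norm (\<phi> x)) \<partial>lborel) \<le>
    (\<integral>\<^sup>+x. ennreal B * indicator (cball 0 1) x +
       ennreal B * (ennreal (norm x powr (- real ?k)) * indicator {x::'a. 1 \<le> norm x} x) \<partial>lborel)"
  proof (rule nn_integral_mono)
    fix x :: 'a
    show "ennreal (norm (\<phi> x)) \<le> ennreal B * indicator (cball 0 1) x +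
       ennreal B * (ennreal (norm x powr (- real ?k)) * indicator {x::'a. 1 \<le> norm x} x)"
    proof (cases "norm x \<le> 1")
      case True
      have "1 * norm (\<phi> x) \<le> (1 + norm x) ^ ?k * norm (\<phi> x)"
        by (intro mult_right_mono one_le_power) auto
      then have "norm (\<phi> x) \<le> B" using B(2)[of x] by linarith
      then show ?thesis using True by (auto intro!: add_increasing2 ennreal_leI)
    next
      case False
      then have x: "norm x > 0" by linarith
      have "norm x ^ ?k * norm (\<phi> x) \<le> (1 + norm x) ^ ?k * norm (\<phi> x)"
        by (intro mult_right_mono power_mono) auto
      then have "norm x ^ ?k * norm (\<phi> x) \<le> B" using B(2)[of x] by linarith
      then have "norm (\<phi> x) \<le> B * norm x powr (- real ?k)"
        using x by (subst powr_minus, subst powr_realpow) (auto simp: field_simps)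
      then show ?thesis
        using False B(1) by (simp add: ennreal_mult'[symmetric] ennreal_leI)
    qed
  qed
  also have "\<dots> = ennreal B * emeasure lborel (cball (0::'a) 1) +
      ennreal B * (\<integral>\<^sup>+x. ennreal (norm x powr (- real ?k)) * indicator {x::'a. 1 \<le> norm x} x \<partial>lborel)"
    by (simp add: nn_integral_add nn_integral_cmult nn_integral_cmult_indicator)
  also have "\<dots> < \<infinity>"
    by (subst nn_integral_norm_powr_outside)
      (auto simp: emeasure_cball ennreal_mult_less_top)
  finally show ?thesis
    by (auto simp: integrable_iff_bounded)
qed

text \<open>Fubini moves the inverse transform from the test function back to the symbol side. The
  kernel \<open>G\<close> is absolutely integrable on the product because its modulus is that of
  \<open>F \<xi>\<close> times that of \<open>\<phi> x\<close>, both integrable.\<close>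

lemma represents_fourier_multiplier:
  fixes g :: "'a::euclidean_space \<Rightarrow> complex"
  assumes F: "integrable lborel (\<lambda>\<xi>. complex_of_real (\<sigma> \<xi>) * fourier g \<xi>)"
  shows "represents (inv_fourier (\<lambda>\<xi>. complex_of_real (\<sigma> \<xi>) * fourier g \<xi>)) (fourier_multiplier \<sigma> g)"
proof -
  let ?c = "complex_of_real ((2 * pi) powr (- real DIM('a) / 2))"
  define F where "F = (\<lambda>\<xi>. complex_of_real (\<sigma> \<xi>) * fourier g \<xi>)"
  have int: "integrable lborel F" using assms by (simp add: F_def)
  then have [measurable]: "F \<in> borel_measurable borel" by auto
  have "integrable lborel (\<lambda>x. inv_fourier F x * \<phi> x) \<and>
      fourier_multiplier \<sigma> g \<phi> = (LINT x|lborel. inv_fourier F x * \<phi> x)"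
    if "schwartz \<phi>" for \<phi> :: "'a \<Rightarrow> complex"
  proof -
    have \<phi>: "integrable lborel \<phi>" by (rule schwartz_integrable) fact
    then have [measurable]: "\<phi> \<in> borel_measurable borel" by auto
    define G where "G = (\<lambda>x \<xi>. cis (x \<bullet> \<xi>) * F \<xi> * \<phi> x)"
    have G: "integrable (lborel \<Otimes>\<^sub>M lborel) (case_prod G)"
    proof (rule lborel_pair.Fubini_integrable)
      show "case_prod G \<in> borel_measurable (lborel \<Otimes>\<^sub>M lborel)"
        unfolding G_def by measurable
      show "integrable lborel (\<lambda>x. LINT \<xi>|lborel. norm (case (x, \<xi>) of (x, \<xi>) \<Rightarrow> G x \<xi>))"
        using \<phi> by (simp add: G_def norm_mult)
      have "integrable lborel (G x)" for x
        unfolding G_def using int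
        by (intro integrable_mult_left, subst integrable_norm_iff[symmetric])
          (auto simp: norm_mult)
      then show "AE x in lborel. integrable lborel (\<lambda>\<xi>. case (x, \<xi>) of (x, \<xi>) \<Rightarrow> G x \<xi>)"
        by simp
    qed
    have inv: "inv_fourier F x * \<phi> x = ?c * (LINT \<xi>|lborel. G x \<xi>)" for x
      by (simp add: inv_fourier_def G_def)
    have "integrable lborel (\<lambda>x. inv_fourier F x * \<phi> x)"
      unfolding inv by (intro integrable_mult_right lborel_pair.integrable_fst G)
    moreover have "fourier_multiplier \<sigma> g \<phi> = (LINT x|lborel. inv_fourier F x * \<phi> x)"
    proof -
      have "fourier_multiplier \<sigma> g \<phi> = (LINT \<xi>|lborel. ?c * (LINT x|lborel. G x \<xi>))"
        unfolding fourier_multiplier_def inv_fourier_def G_def F_def[symmetric]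
        by (intro Bochner_Integration.integral_cong refl)
           (simp add: F_def inner_commute mult_ac flip: integral_mult_right_zero integral_mult_left_zero)
      also have "\<dots> = ?c * (LINT x|lborel. LINT \<xi>|lborel. G x \<xi>)"
        using lborel_pair.Fubini_integral[OF G] by simp
      finally show ?thesis unfolding inv by simp
    qed
    ultimately show ?thesis by blast
  qed
  then show ?thesis
    unfolding represents_def F_def[symmetric] by simp
qed

text \<open>The infimum in \<open>Linf_norm\<close> is at most the essential supremum of one
  representative, here the inverse transform, which is bounded pointwise by an integral.\<close>

lemma Linf_norm_fourier_multiplier_le:
  fixes g :: "'a::euclidean_space \<Rightarrow> complex"
  assumes [measurable]: "\<sigma> \<in> borel_measurable borel" "g \<in> borel_measurable borel"
  shows "Linf_norm (fourier_multiplier \<sigma> g) \<le>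
    ennreal ((2 * pi) powr (- real DIM('a) / 2)) * (\<integral>\<^sup>+\<xi>. ennreal (\<bar>\<sigma> \<xi>\<bar> * norm (fourier g \<xi>)) \<partial>lborel)"
proof (cases "(\<integral>\<^sup>+\<xi>. ennreal (\<bar>\<sigma> \<xi>\<bar> * norm (fourier g \<xi>)) \<partial>lborel) = \<infinity>")
  case True
  \<comment> \<open>The constant is nonzero, so the right-hand side is really infinite and not
    \<open>0 * \<infinity> = 0\<close>.\<close>
  then show ?thesis by (simp add: ennreal_mult_top)
next
  case False
  let ?F = "\<lambda>\<xi>. complex_of_real (\<sigma> \<xi>) * fourier g \<xi>"
  have F: "integrable lborel ?F"
    using False by (auto simp: integrable_iff_bounded norm_mult top.not_eq_extremum)
  have "Linf_norm (fourier_multiplier \<sigma> g) \<le> esssup lborel (\<lambda>x. ennreal (norm (inv_fourier ?F x)))"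
    unfolding Linf_norm_def using represents_fourier_multiplier[OF F] by (intro Inf_lower) auto
  also have "\<dots> \<le> ennreal ((2 * pi) powr (- real DIM('a) / 2)) * (\<integral>\<^sup>+\<xi>. norm (?F \<xi>) \<partial>lborel)"
    using ennreal_norm_inv_fourier_le[OF F] by (intro esssup_I) auto
  finally show ?thesis by (simp add: norm_mult)
qed

section \<open>The symbol of the operator\<close>

definition Lambda_symbol :: "real \<Rightarrow> real \<Rightarrow> 'a::euclidean_space \<Rightarrow> real" where
  "Lambda_symbol \<theta> t \<xi> = S_symbol t \<xi> * inverse (1 + (norm \<xi>)\<^sup>2) * frac_laplace_symbol \<theta> \<xi>"

lemma borel_measurable_Lambda_symbol [measurable]:
  "Lambda_symbol \<theta> t \<in> borel_measurable (borel :: 'a::euclidean_space measure)"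
proof -
  have [measurable]: "frac_laplace_symbol \<theta> \<in> borel_measurable (borel :: 'a measure)"
    unfolding frac_laplace_symbol_def by (cases "\<theta> = 0") auto
  have [measurable]: "S_symbol t \<in> borel_measurable (borel :: 'a measure)"
    unfolding S_symbol_def by measurable
  show ?thesis
    unfolding Lambda_symbol_def by measurable
qed

text \<open>The factor \<open>1 + (norm \<xi>)\<^sup>2\<close> in the numerator of
  \<open>S_symbol\<close> cancels against the inverse of the same factor, and the sine is bounded by
  1.\<close>

lemma abs_Lambda_symbol_le:
  fixes \<xi> :: "'a::euclidean_space"
  assumes "\<xi> \<noteq> 0"
  shows "\<bar>Lambda_symbol \<theta> t \<xi>\<bar> \<le> exp (- ((norm \<xi>)\<^sup>2 * t) / (2 * (1 + (norm \<xi>)\<^sup>2))) *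
    (2 / sqrt (3 + 4 * (norm \<xi>)\<^sup>2)) * norm \<xi> powr (2 * \<theta> - 2)"
proof -
  define r where "r = norm \<xi>"
  define E where "E = exp (- (r\<^sup>2 * t) / (2 * (1 + r\<^sup>2)))"
  define q where "q = sqrt (3 + 4 * r\<^sup>2)"
  define w where "w = 1 + r\<^sup>2"
  define z where "z = r\<^sup>2 * q * t / (2 * w)"
  have r: "r > 0" using assms by (simp add: r_def)
  have w: "w > 0" by (simp add: w_def add_pos_nonneg)
  have q: "q > 0" by (simp add: q_def add_pos_nonneg)
  \<comment> \<open>For \<open>\<theta> = 0\<close> this agrees with the separate case of the
    definition, because \<open>r powr 0 = 1\<close> away from the origin.\<close>
  have "frac_laplace_symbol \<theta> \<xi> = r powr (2 * \<theta>)"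
    using r by (auto simp: frac_laplace_symbol_def r_def)
  then have "Lambda_symbol \<theta> t \<xi> = E * (2 * w / (r\<^sup>2 * q)) * sin z * inverse w * r powr (2 * \<theta>)"
    using assms by (simp add: Lambda_symbol_def S_symbol_def E_def q_def w_def z_def r_def)
  also have "\<dots> = E * (2 / q) * (r powr (2 * \<theta>) / r\<^sup>2) * sin z"
    using r w q by (simp add: field_simps)
  also have "r powr (2 * \<theta>) / r\<^sup>2 = r powr (2 * \<theta> - 2)"
    using r by (simp add: powr_diff)
  finally have "\<bar>Lambda_symbol \<theta> t \<xi>\<bar> = E * (2 / q) * r powr (2 * \<theta> - 2) * \<bar>sin z\<bar>"
    using q by (simp add: abs_mult E_def)
  also have "\<dots> \<le> E * (2 / q) * r powr (2 * \<theta> - 2)"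
    using q by (intro mult_left_le) (auto simp: E_def)
  finally show ?thesis
    by (simp add: E_def q_def r_def)
qed

text \<open>On the unit ball \<open>2 * (1 + (norm \<xi>)\<^sup>2) \<le> 4\<close>. Replacing
  \<open>t\<close> by \<open>1 + t\<close> in the Gaussian costs at most \<open>exp (1 / 4)\<close>
  and keeps its integral bounded as \<open>t\<close> tends to 0.\<close>

lemma abs_Lambda_symbol_low:
  fixes \<xi> :: "'a::euclidean_space"
  assumes "\<xi> \<noteq> 0" "norm \<xi> \<le> 1" "0 \<le> t"
  shows "\<bar>Lambda_symbol \<theta> t \<xi>\<bar> \<le>
    2 * exp (1 / 4) * (norm \<xi> powr (2 * \<theta> - 2) * exp (- ((1 + t) * (norm \<xi>)\<^sup>2) / 4))"
proof -
  define r where "r = norm \<xi>"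
  have r: "0 < r" "r \<le> 1" using assms by (auto simp: r_def)
  have r2: "r\<^sup>2 \<le> 1" using r by (simp add: power_le_one)
  have "2 * (1 + r\<^sup>2) \<le> 4" using r2 by simp
  then have "r\<^sup>2 * t / 4 \<le> r\<^sup>2 * t / (2 * (1 + r\<^sup>2))"
    using assms(3) by (intro divide_left_mono) (auto intro!: mult_pos_pos add_pos_nonneg)
  moreover have "r\<^sup>2 * t / 4 = (1 + t) * r\<^sup>2 / 4 - r\<^sup>2 / 4"
    by (simp add: field_simps)
  ultimately have "- (r\<^sup>2 * t) / (2 * (1 + r\<^sup>2)) \<le> 1 / 4 + - ((1 + t) * r\<^sup>2) / 4"
    using r2 by (simp add: field_simps)
  then have E: "exp (- (r\<^sup>2 * t) / (2 * (1 + r\<^sup>2))) \<le> exp (1 / 4) * exp (- ((1 + t) * r\<^sup>2) / 4)"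
    unfolding exp_add[symmetric] by simp
  have "1 \<le> sqrt (3 + 4 * r\<^sup>2)"
    by (simp add: real_le_rsqrt)
  then have q: "2 / sqrt (3 + 4 * r\<^sup>2) \<le> 2"
    by (simp add: divide_le_eq)
  have "\<bar>Lambda_symbol \<theta> t \<xi>\<bar> \<le> exp (- (r\<^sup>2 * t) / (2 * (1 + r\<^sup>2))) * (2 / sqrt (3 + 4 * r\<^sup>2)) * r powr (2 * \<theta> - 2)"
    using abs_Lambda_symbol_le[OF assms(1)] by (simp add: r_def)
  also have "\<dots> \<le> (exp (1 / 4) * exp (- ((1 + t) * r\<^sup>2) / 4)) * 2 * r powr (2 * \<theta> - 2)"
    by (intro mult_right_mono mult_mono E q) auto
  finally show ?thesis by (simp add: r_def mult_ac)
qed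

text \<open>Here \<open>(norm \<xi>)\<^sup>2 / (1 + (norm \<xi>)\<^sup>2) \<ge> 1 / 2\<close>, hence
  decay uniform in the frequency; the square root is at least \<open>2 * norm \<xi>\<close> and
  lowers the exponent from \<open>2 * \<theta> - 2\<close> to
  \<open>2 * \<theta> - 3\<close>.\<close>

lemma abs_Lambda_symbol_high:
  fixes \<xi> :: "'a::euclidean_space"
  assumes "1 \<le> norm \<xi>" "0 \<le> t"
  shows "\<bar>Lambda_symbol \<theta> t \<xi>\<bar> \<le> exp (- t / 4) * norm \<xi> powr (2 * \<theta> - 3)"
proof -
  define r where "r = norm \<xi>"
  have r: "1 \<le> r" using assms by (auto simp: r_def)
  then have "1 \<le> r\<^sup>2" by simp
  then have "2 * (1 + r\<^sup>2) * t \<le> 4 * (r\<^sup>2 * t)"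
    using mult_right_mono[OF \<open>1 \<le> r\<^sup>2\<close> assms(2)] by (simp add: algebra_simps)
  then have "t / 4 \<le> r\<^sup>2 * t / (2 * (1 + r\<^sup>2))"
    by (subst le_divide_eq) (auto simp: algebra_simps add_pos_nonneg)
  then have E: "exp (- (r\<^sup>2 * t) / (2 * (1 + r\<^sup>2))) \<le> exp (- t / 4)"
    by simp
  have "2 * r \<le> sqrt (3 + 4 * r\<^sup>2)"
    by (rule real_le_rsqrt) (simp add: power_mult_distrib)
  then have q: "2 / sqrt (3 + 4 * r\<^sup>2) \<le> 1 / r"
    using r by (subst frac_le_eq) (auto simp: divide_le_0_iff mult_ac)
  have "\<xi> \<noteq> 0" using assms by auto
  then have "\<bar>Lambda_symbol \<theta> t \<xi>\<bar> \<le> exp (- (r\<^sup>2 * t) / (2 * (1 + r\<^sup>2))) * (2 / sqrt (3 + 4 * r\<^sup>2)) * r powr (2 * \<theta> - 2)"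
    using abs_Lambda_symbol_le by (simp add: r_def)
  also have "\<dots> \<le> exp (- t / 4) * (1 / r) * r powr (2 * \<theta> - 2)"
    using r by (intro mult_right_mono mult_mono E q) auto
  also have "\<dots> = exp (- t / 4) * r powr (2 * \<theta> - 3)"
    using r by (simp add: powr_diff field_simps power2_eq_square power3_eq_cube)
  finally show ?thesis by (simp add: r_def)
qed

section \<open>High frequencies: Sobolev weight and Cauchy-Schwarz\<close>

text \<open>From \<open>r\<^sup>2 \<le> 1 + r\<^sup>2 \<le> 2 * r\<^sup>2\<close>: the sign of
  \<open>s\<close> decides which inequality is used, and the factor
  \<open>2 powr \<bar>s\<bar>\<close> covers both cases.\<close>

lemma one_plus_square_powr_le:
  fixes r s :: real
  assumes "1 \<le> r"
  shows "(1 + r\<^sup>2) powr (- s) \<le> 2 powr \<bar>s\<bar> * r powr (- 2 * s)"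
proof (cases "0 \<le> s")
  case True
  have "(1 + r\<^sup>2) powr (- s) \<le> (r\<^sup>2) powr (- s)"
    using True assms by (intro powr_mono2') auto
  also have "\<dots> = 1 * r powr (- 2 * s)"
    using assms by (simp add: powr_powr flip: powr_numeral)
  also have "\<dots> \<le> 2 powr \<bar>s\<bar> * r powr (- 2 * s)"
    by (intro mult_right_mono ge_one_powr_ge_zero) auto
  finally show ?thesis .
next
  case False
  have "(1 + r\<^sup>2) powr (- s) \<le> (2 * r\<^sup>2) powr (- s)"
    using False assms by (intro powr_mono2) auto
  also have "\<dots> = 2 powr \<bar>s\<bar> * r powr (- 2 * s)"
    using assms False by (simp add: powr_mult powr_powr flip: powr_numeral)
  finally show ?thesis .
qed

text \<open>At infinity the integrand is comparable to the power \<open>2 * q - 2 * s\<close>, so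
  \<open>d\<close> is exactly the condition for convergence.\<close>

lemma nn_integral_Bessel_weight_outside:
  fixes q s :: real
  assumes d: "real DIM('a) + 2 * q - 2 * s < 0"
  shows "(\<integral>\<^sup>+\<xi>. ennreal (norm (\<xi>::'a::euclidean_space) powr (2 * q) * (1 + (norm \<xi>)\<^sup>2) powr (- s)) * indicator {\<xi>. 1 \<le> norm \<xi>} \<xi> \<partial>lborel)
    \<le> ennreal (2 powr \<bar>s\<bar> * (real DIM('a) * unit_ball_vol (real DIM('a)) / (2 * s - 2 * q - real DIM('a))))"
proof -
  let ?f = "\<lambda>\<xi>::'a. ennreal (norm \<xi> powr (2 * q) * (1 + (norm \<xi>)\<^sup>2) powr (- s)) * indicator {\<xi>. 1 \<le> norm \<xi>} \<xi>"
  have "(\<integral>\<^sup>+\<xi>. ?f \<xi> \<partial>lborel) \<le> (\<integral>\<^sup>+\<xi>. ennreal (2 powr \<bar>s\<bar>) *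
      (ennreal (norm (\<xi>::'a) powr (2 * q - 2 * s)) * indicator {\<xi>. 1 \<le> norm \<xi>} \<xi>) \<partial>lborel)"
  proof (rule nn_integral_mono)
    fix \<xi> :: 'a
    have "norm \<xi> powr (2 * q) * (1 + (norm \<xi>)\<^sup>2) powr (- s) \<le> 2 powr \<bar>s\<bar> * norm \<xi> powr (2 * q - 2 * s)"
      if "1 \<le> norm \<xi>"
    proof -
      have "norm \<xi> powr (2 * q) * (1 + (norm \<xi>)\<^sup>2) powr (- s) \<le>
          norm \<xi> powr (2 * q) * (2 powr \<bar>s\<bar> * norm \<xi> powr (- 2 * s))"
        by (intro mult_left_mono one_plus_square_powr_le that) auto
      also have "\<dots> = 2 powr \<bar>s\<bar> * (norm \<xi> powr (2 * q) * norm \<xi> powr (- 2 * s))"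
        by simp
      also have "norm \<xi> powr (2 * q) * norm \<xi> powr (- 2 * s) = norm \<xi> powr (2 * q - 2 * s)"
        by (simp add: powr_add[symmetric])
      finally show ?thesis .
    qed
    then show "?f \<xi> \<le> ennreal (2 powr \<bar>s\<bar>) *
      (ennreal (norm \<xi> powr (2 * q - 2 * s)) * indicator {\<xi>. 1 \<le> norm \<xi>} \<xi>)"
      by (auto simp: indicator_def ennreal_mult'[symmetric] ennreal_leI)
  qed
  also have "\<dots> = ennreal (2 powr \<bar>s\<bar>) *
      ennreal (real DIM('a) * unit_ball_vol (real DIM('a)) *
        (- (1 powr (real DIM('a) + (2 * q - 2 * s))) / (real DIM('a) + (2 * q - 2 * s))))"
    using d by (subst nn_integral_cmult, simp, subst nn_integral_norm_powr_outside) auto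
  also have "- (1 powr (real DIM('a) + (2 * q - 2 * s))) / (real DIM('a) + (2 * q - 2 * s)) =
      1 / (2 * s - 2 * q - real DIM('a))"
    using d by (simp add: field_simps)
  finally show ?thesis by (simp add: ennreal_mult'[symmetric])
qed

lemma ennreal_power2_le_imp_le:
  fixes x :: ennreal
  assumes "x\<^sup>2 \<le> (ennreal b)\<^sup>2" "0 \<le> b"
  shows "x \<le> ennreal b"
  using assms by (cases x) (auto simp: ennreal_power top_unique intro!: ennreal_leI elim: power2_le_imp_le)

text \<open>Cauchy-Schwarz after inserting the weights of exponent \<open>- s / 2\<close> and
  \<open>s / 2\<close>. For \<open>q = 2 * \<theta> - 3\<close> the condition \<open>d\<close>
  becomes the lower bound on \<open>s\<close> in the theorem.\<close>

lemma nn_integral_fourier_outside_le: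
  fixes g :: "'a::euclidean_space \<Rightarrow> complex"
  assumes [measurable]: "g \<in> borel_measurable borel"
    and Hs: "in_Hs s g"
    and d: "real DIM('a) + 2 * q - 2 * s < 0"
  shows "(\<integral>\<^sup>+\<xi>. ennreal (norm \<xi> powr q * norm (fourier g \<xi>)) * indicator {\<xi>. 1 \<le> norm \<xi>} \<xi> \<partial>lborel)
    \<le> ennreal (sqrt (2 powr \<bar>s\<bar> * (real DIM('a) * unit_ball_vol (real DIM('a)) / (2 * s - 2 * q - real DIM('a)))) * Hs_norm s g)"
    (is "?I \<le> ennreal (sqrt ?M * _)")
proof -
  \<comment> \<open>The indicator goes entirely into \<open>w\<close>, so that \<open>v\<close>
    integrates over the whole space to the Sobolev norm.\<close>
  define w where "w = (\<lambda>\<xi>::'a. ennreal (norm \<xi> powr q * (1 + (norm \<xi>)\<^sup>2) powr (- s / 2)) * indicator {\<xi>. 1 \<le> norm \<xi>} \<xi>)"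
  define v where "v = (\<lambda>\<xi>::'a. ennreal ((1 + (norm \<xi>)\<^sup>2) powr (s / 2) * norm (fourier g \<xi>)))"
  have [measurable]: "w \<in> borel_measurable borel" "v \<in> borel_measurable borel"
    unfolding w_def v_def by measurable
  have M: "0 \<le> ?M" using d by simp
  have pos: "1 + (norm \<xi>)\<^sup>2 \<noteq> 0" for \<xi> :: 'a
    using zero_le_power2[of "norm \<xi>"] by linarith
  have I: "?I = (\<integral>\<^sup>+\<xi>. w \<xi> * v \<xi> \<partial>lborel)"
  proof (intro nn_integral_cong)
    fix \<xi> :: 'a
    have "(1 + (norm \<xi>)\<^sup>2) powr (- s / 2) * (1 + (norm \<xi>)\<^sup>2) powr (s / 2) = 1"
      using pos by (simp add: powr_add[symmetric])
    then have "norm \<xi> powr q * norm (fourier g \<xi>) =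
      norm \<xi> powr q * (1 + (norm \<xi>)\<^sup>2) powr (- s / 2) * ((1 + (norm \<xi>)\<^sup>2) powr (s / 2) * norm (fourier g \<xi>))"
      by (simp add: mult.assoc[symmetric])
    then show "ennreal (norm \<xi> powr q * norm (fourier g \<xi>)) * indicator {\<xi>. 1 \<le> norm \<xi>} \<xi> = w \<xi> * v \<xi>"
      by (simp add: w_def v_def indicator_def ennreal_mult'[symmetric])
  qed
  have w: "(\<integral>\<^sup>+\<xi>. (w \<xi>)\<^sup>2 \<partial>lborel) \<le> ennreal ?M"
  proof -
    have "(w \<xi>)\<^sup>2 = ennreal (norm \<xi> powr (2 * q) * (1 + (norm \<xi>)\<^sup>2) powr (- s)) * indicator {\<xi>. 1 \<le> norm \<xi>} \<xi>" for \<xi>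
    proof -
      have "(norm \<xi> powr q * (1 + (norm \<xi>)\<^sup>2) powr (- s / 2))\<^sup>2 =
          (norm \<xi> powr q * norm \<xi> powr q) * ((1 + (norm \<xi>)\<^sup>2) powr (- s / 2) * (1 + (norm \<xi>)\<^sup>2) powr (- s / 2))"
        by (simp add: power2_eq_square)
      also have "\<dots> = norm \<xi> powr (2 * q) * (1 + (norm \<xi>)\<^sup>2) powr (- s)"
        by (simp only: powr_add[symmetric]) simp
      finally show ?thesis
        by (simp add: w_def indicator_def ennreal_power)
    qed
    then show ?thesis
      using nn_integral_Bessel_weight_outside[OF d] by simp
  qed
  have v: "(\<integral>\<^sup>+\<xi>. (v \<xi>)\<^sup>2 \<partial>lborel) = ennreal ((Hs_norm s g)\<^sup>2)"
  proof -
    have "(v \<xi>)\<^sup>2 = ennreal ((1 + (norm \<xi>)\<^sup>2) powr s * (norm (fourier g \<xi>))\<^sup>2)" for \<xi>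
    proof -
      have "((1 + (norm \<xi>)\<^sup>2) powr (s / 2))\<^sup>2 = (1 + (norm \<xi>)\<^sup>2) powr s"
        by (simp only: power2_eq_square[of "_ powr _"] powr_add[symmetric]) simp
      then show ?thesis
        by (simp add: v_def ennreal_power power_mult_distrib)
    qed
    then show ?thesis
      \<comment> \<open>Membership in the Sobolev space identifies the two kinds of integral; the
        Bochner integral in \<open>Hs_norm\<close> would otherwise default to 0.\<close>
      using Hs unfolding in_Hs_def Hs_norm_def
      by (simp add: nn_integral_eq_integral)
  qed
  have "?I\<^sup>2 \<le> (\<integral>\<^sup>+\<xi>. (w \<xi>)\<^sup>2 \<partial>lborel) * (\<integral>\<^sup>+\<xi>. (v \<xi>)\<^sup>2 \<partial>lborel)"
    unfolding I by (rule Cauchy_Schwarz_nn_integral) simp_all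
  also have "\<dots> \<le> ennreal ?M * ennreal ((Hs_norm s g)\<^sup>2)"
    unfolding v by (intro mult_right_mono w) simp
  also have "\<dots> = (ennreal (sqrt ?M * Hs_norm s g))\<^sup>2"
    using M by (simp add: ennreal_mult'[symmetric] ennreal_power power_mult_distrib Hs_norm_def)
  finally show ?thesis
    using M by (elim ennreal_power2_le_imp_le) (auto simp: Hs_norm_def intro!: mult_nonneg_nonneg integral_nonneg)
qed

section \<open>Joining low and high frequencies\<close>

text \<open>\<open>A\<close> collects the low-frequency symbol bound, the Fourier constant and the
  Gaussian integral. \<open>B\<close> is the Cauchy-Schwarz constant times the price of trading
  \<open>exp (- t / 4)\<close> for a power of \<open>1 + t\<close>; it depends on \<open>s\<close>
  too and blows up as \<open>s\<close> approaches its lower bound.\<close>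

lemma nn_integral_Lambda_symbol_fourier_le:
  fixes g :: "'a::euclidean_space \<Rightarrow> complex" and \<theta> s t :: real
  defines "n \<equiv> real DIM('a)" and "a \<equiv> real DIM('a) + 2 * \<theta> - 2"
  defines "A \<equiv> 2 * exp (1 / 4) * (2 * pi) powr (- n / 2) * (n * unit_ball_vol n * (1 + (4 * a) powr a) / a)"
    and "B \<equiv> exp (1 / 4) * (2 * a) powr (a / 2) *
      sqrt (2 powr \<bar>s\<bar> * (n * unit_ball_vol n / (2 * s - 2 * (2 * \<theta> - 3) - n)))"
  assumes [measurable]: "g \<in> borel_measurable borel"
    and Hs: "in_Hs s g" and a: "0 < a" and s: "n + 4 * \<theta> - 6 < 2 * s" and t: "0 \<le> t"
  shows "(\<integral>\<^sup>+\<xi>. ennreal (\<bar>Lambda_symbol \<theta> t \<xi>\<bar> * norm (fourier g \<xi>)) \<partial>lborel) \<le>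
    ennreal ((1 + t) powr (- a / 2) * (A * L1_norm g + B * Hs_norm s g))"
proof -
  define c where "c = (2 * pi) powr (- n / 2) * L1_norm g"
  define S where "S = sqrt (2 powr \<bar>s\<bar> * (n * unit_ball_vol n / (2 * s - 2 * (2 * \<theta> - 3) - n)))"
  define V where "V = n * unit_ball_vol n * (1 + (4 * a) powr a) / a"
  have nonneg: "0 \<le> c" "0 \<le> S" "0 \<le> V" "0 \<le> L1_norm g" "0 \<le> Hs_norm s g"
    using s a by (auto simp: c_def S_def V_def L1_norm_def Hs_norm_def n_def intro!: integral_nonneg)
  let ?low = "\<lambda>\<xi>::'a. norm \<xi> powr (2 * \<theta> - 2) * exp (- ((1 + t) * (norm \<xi>)\<^sup>2) / 4)"
  let ?high = "\<lambda>\<xi>::'a. ennreal (norm \<xi> powr (2 * \<theta> - 3) * norm (fourier g \<xi>)) * indicator {\<xi>. 1 \<le> norm \<xi>} \<xi>"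
  \<comment> \<open>The low-frequency majorant carries no indicator, so that the Gaussian integral
    over the whole space applies.\<close>
  have "(\<integral>\<^sup>+\<xi>. ennreal (\<bar>Lambda_symbol \<theta> t \<xi>\<bar> * norm (fourier g \<xi>)) \<partial>lborel) \<le>
      (\<integral>\<^sup>+\<xi>. ennreal (2 * exp (1 / 4) * c) * ennreal (?low \<xi>) + ennreal (exp (- t / 4)) * ?high \<xi> \<partial>lborel)"
  \<comment> \<open>The origin is left out as a null set: there
    \<open>0 powr (2 * \<theta> - 2) = 0\<close> makes the majorant vanish, while for
    \<open>\<theta> = 0\<close> the symbol equals \<open>t\<close>.\<close>
  proof (rule nn_integral_mono_AE, rule AE_mp[OF AE_lborel_singleton[of 0]], intro AE_I2 impI)
    fix \<xi> :: 'a assume "\<xi> \<noteq> 0"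
    show "ennreal (\<bar>Lambda_symbol \<theta> t \<xi>\<bar> * norm (fourier g \<xi>)) \<le>
      ennreal (2 * exp (1 / 4) * c) * ennreal (?low \<xi>) + ennreal (exp (- t / 4)) * ?high \<xi>"
    proof (cases "norm \<xi> \<le> 1")
      case True
      have "\<bar>Lambda_symbol \<theta> t \<xi>\<bar> * norm (fourier g \<xi>) \<le> (2 * exp (1 / 4) * ?low \<xi>) * c"
        using norm_fourier_le[of g \<xi>] abs_Lambda_symbol_low[OF \<open>\<xi> \<noteq> 0\<close> True t]
        by (intro mult_mono) (auto simp: c_def n_def)
      also have "\<dots> = 2 * exp (1 / 4) * c * ?low \<xi>" by simp
      finally have "ennreal (\<bar>Lambda_symbol \<theta> t \<xi>\<bar> * norm (fourier g \<xi>)) \<le> ennreal (2 * exp (1 / 4) * c * ?low \<xi>)"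
        by (rule ennreal_leI)
      also have "\<dots> = ennreal (2 * exp (1 / 4) * c) * ennreal (?low \<xi>)"
        using nonneg by (intro ennreal_mult') auto
      finally show ?thesis by (rule add_increasing2[rotated]) simp
    next
      case False
      have "\<bar>Lambda_symbol \<theta> t \<xi>\<bar> * norm (fourier g \<xi>) \<le>
          exp (- t / 4) * norm \<xi> powr (2 * \<theta> - 3) * norm (fourier g \<xi>)"
        using False by (intro mult_right_mono abs_Lambda_symbol_high t) auto
      then have "ennreal (\<bar>Lambda_symbol \<theta> t \<xi>\<bar> * norm (fourier g \<xi>)) \<le> ennreal (exp (- t / 4)) * ?high \<xi>"
        using False by (simp add: ennreal_mult'[symmetric] ennreal_leI mult.assoc)
      then show ?thesis by (rule add_increasing[rotated]) simp
    qed
  qed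
  also have "\<dots> = ennreal (2 * exp (1 / 4) * c) * (\<integral>\<^sup>+\<xi>. ennreal (?low \<xi>) \<partial>lborel) +
      ennreal (exp (- t / 4)) * (\<integral>\<^sup>+\<xi>. ?high \<xi> \<partial>lborel)"
    by (simp add: nn_integral_add nn_integral_cmult)
  also have "\<dots> \<le> ennreal (2 * exp (1 / 4) * c) * ennreal (V * (1 + t) powr (- a / 2)) +
      ennreal (exp (- t / 4)) * ennreal (S * Hs_norm s g)"
  proof (intro add_mono mult_left_mono)
    have e: "real DIM('a) + (2 * \<theta> - 2) = a" by (simp add: a_def)
    show "(\<integral>\<^sup>+\<xi>. ennreal (?low \<xi>) \<partial>lborel) \<le> ennreal (V * (1 + t) powr (- a / 2))"
      using nn_integral_norm_powr_gaussian[where 'a = 'a and p = "2 * \<theta> - 2" and \<tau> = "1 + t"] a t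
      unfolding e V_def n_def by simp
    show "(\<integral>\<^sup>+\<xi>. ?high \<xi> \<partial>lborel) \<le> ennreal (S * Hs_norm s g)"
      using nn_integral_fourier_outside_le[OF _ Hs, of "2 * \<theta> - 3"] s
      unfolding S_def n_def by simp
  qed auto
  also have "\<dots> = ennreal (2 * exp (1 / 4) * c * (V * (1 + t) powr (- a / 2)) + exp (- t / 4) * (S * Hs_norm s g))"
    using nonneg by (simp add: ennreal_mult'[symmetric] ennreal_plus[symmetric] del: ennreal_plus)
  also have "\<dots> \<le> ennreal ((1 + t) powr (- a / 2) * (A * L1_norm g + B * Hs_norm s g))"
  proof (rule ennreal_leI)
    \<comment> \<open>The exponential decay is weakened to the low-frequency rate: the exponent
      \<open>a / 2\<close> gives the constant \<open>4 * (a / 2) = 2 * a\<close>, and the shift from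
      \<open>t\<close> to \<open>1 + t\<close> gives \<open>exp (1 / 4)\<close>.\<close>
    have "(1 + t) powr (a / 2) * exp (- (1 + t) / 4) \<le> (2 * a) powr (a / 2)"
      using powr_exp_bound[of "a / 2" "1 + t"] a t by simp
    moreover have "exp (- t / 4) = exp (1 / 4) * exp (- (1 + t) / 4)"
      by (simp add: exp_add[symmetric] field_simps)
    ultimately have "(1 + t) powr (a / 2) * exp (- t / 4) \<le> exp (1 / 4) * (2 * a) powr (a / 2)"
      by simp
    then have "exp (- t / 4) \<le> exp (1 / 4) * (2 * a) powr (a / 2) * (1 + t) powr (- a / 2)"
      using t by (simp add: powr_minus field_simps)
    then have "exp (- t / 4) * (S * Hs_norm s g) \<le>
        exp (1 / 4) * (2 * a) powr (a / 2) * (1 + t) powr (- a / 2) * (S * Hs_norm s g)"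
      using nonneg by (intro mult_right_mono) auto
    moreover have "A = 2 * exp (1 / 4) * (2 * pi) powr (- n / 2) * V" "B = exp (1 / 4) * (2 * a) powr (a / 2) * S"
      by (simp_all only: A_def B_def V_def S_def)
    ultimately show "2 * exp (1 / 4) * c * (V * (1 + t) powr (- a / 2)) + exp (- t / 4) * (S * Hs_norm s g) \<le>
        (1 + t) powr (- a / 2) * (A * L1_norm g + B * Hs_norm s g)"
      by (simp add: c_def algebra_simps)
  qed
  finally show ?thesis .
qed

theorem lemma3p3:
  fixes \<theta> s :: real
  assumes theta: "if CARD('n::finite) \<le> 2
                  then (2 - real CARD('n)) / 2 < \<theta> \<and> \<theta> \<le> 1
                  else 0 \<le> \<theta> \<and> \<theta> \<le> 1"
    and s: "s > (real CARD('n) + 4 * \<theta> - 6) / 2"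
  shows "\<exists>C>0. \<forall>(g :: real ^ 'n \<Rightarrow> complex) (t::real).
           integrable lborel g \<longrightarrow> in_Hs s g \<longrightarrow> t > 0 \<longrightarrow>
           Linf_norm (Lambda \<theta> t g)
             \<le> ennreal (C * (1 + t) powr (- (real CARD('n) + 2 * (\<theta> - 1)) / 2) *
                        (L1_norm g + Hs_norm s g))"
proof -
  define n where "n = real DIM(real ^ 'n)"
  define a where "a = n + 2 * \<theta> - 2"
  define c where "c = (2 * pi) powr (- n / 2)"
  define A where "A = 2 * exp (1 / 4) * (2 * pi) powr (- n / 2) * (n * unit_ball_vol n * (1 + (4 * a) powr a) / a)"
  define B where "B = exp (1 / 4) * (2 * a) powr (a / 2) *
      sqrt (2 powr \<bar>s\<bar> * (n * unit_ball_vol n / (2 * s - 2 * (2 * \<theta> - 3) - n)))"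
  have n: "n = real CARD('n)" by (simp add: n_def)
  \<comment> \<open>In dimensions 1 and 2 this is the strict lower bound on \<open>\<theta>\<close>;
    from dimension 3 on, \<open>n - 2 > 0\<close> and \<open>\<theta> \<ge> 0\<close> give
    it.\<close>
  have a: "0 < a"
    using theta by (auto simp: a_def n field_simps split: if_splits)
  have s': "n + 4 * \<theta> - 6 < 2 * s" using s n by simp
  have AB: "0 \<le> A" "0 \<le> B" "0 \<le> c"
    using a s' by (auto simp: A_def B_def c_def n)
  \<comment> \<open>The sum \<open>A + B\<close> dominates both coefficients, \<open>c\<close> comes
    from the inverse transform, and the summand 1 makes the constant strictly positive, since
    \<open>AB\<close> gives only nonnegativity.\<close>
  have "Linf_norm (Lambda \<theta> t g) \<le>
      ennreal ((c * (A + B) + 1) * (1 + t) powr (- (real CARD('n) + 2 * (\<theta> - 1)) / 2) * (L1_norm g + Hs_norm s g))"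
    if g: "integrable lborel g" and Hs: "in_Hs s g" and t: "t > 0" for g :: "real ^ 'n \<Rightarrow> complex" and t
  proof -
    have [measurable]: "g \<in> borel_measurable borel" using g by auto
    have N: "0 \<le> L1_norm g" "0 \<le> Hs_norm s g"
      by (auto simp: L1_norm_def Hs_norm_def intro!: integral_nonneg)
    have "Linf_norm (Lambda \<theta> t g) = Linf_norm (fourier_multiplier (Lambda_symbol \<theta> t) g)"
      by (simp add: Lambda_def Lambda_symbol_def[abs_def])
    also have "\<dots> \<le> ennreal c * (\<integral>\<^sup>+\<xi>. ennreal (\<bar>Lambda_symbol \<theta> t \<xi>\<bar> * norm (fourier g \<xi>)) \<partial>lborel)"
      unfolding c_def n_def by (rule Linf_norm_fourier_multiplier_le) auto
    also have "\<dots> \<le> ennreal c * ennreal ((1 + t) powr (- a / 2) * (A * L1_norm g + B * Hs_norm s g))"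
      using nn_integral_Lambda_symbol_fourier_le[of g s \<theta> t] Hs a s' t
      unfolding A_def B_def a_def n_def by (intro mult_left_mono) auto
    also have "\<dots> = ennreal (c * ((1 + t) powr (- a / 2) * (A * L1_norm g + B * Hs_norm s g)))"
      using AB by (simp add: ennreal_mult')
    also have "\<dots> \<le> ennreal ((c * (A + B) + 1) * (1 + t) powr (- a / 2) * (L1_norm g + Hs_norm s g))"
    proof (rule ennreal_leI)
      have "A * L1_norm g + B * Hs_norm s g \<le> (A + B) * (L1_norm g + Hs_norm s g)"
        using AB N by (simp add: algebra_simps)
      then have "c * (A * L1_norm g + B * Hs_norm s g) \<le> c * ((A + B) * (L1_norm g + Hs_norm s g))"
        using AB by (intro mult_left_mono)
      also have "\<dots> \<le> (c * (A + B) + 1) * (L1_norm g + Hs_norm s g)"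
        using N by (simp add: algebra_simps)
      finally have "(1 + t) powr (- a / 2) * (c * (A * L1_norm g + B * Hs_norm s g)) \<le>
          (1 + t) powr (- a / 2) * ((c * (A + B) + 1) * (L1_norm g + Hs_norm s g))"
        by (intro mult_left_mono) auto
      then show "c * ((1 + t) powr (- a / 2) * (A * L1_norm g + B * Hs_norm s g)) \<le>
          (c * (A + B) + 1) * (1 + t) powr (- a / 2) * (L1_norm g + Hs_norm s g)"
        by (simp add: mult_ac)
    qed
    also have "- a / 2 = - (real CARD('n) + 2 * (\<theta> - 1)) / 2"
      by (simp add: a_def n)
    finally show ?thesis .
  qed
  moreover have "0 < c * (A + B) + 1"
    using AB by (intro add_nonneg_pos mult_nonneg_nonneg) auto
  ultimately show ?thesis by blast
qed

end
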